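(* Let $P=\{p_1,\ldots,p_d\}$ and $Q=\{q_1,\ldots,q_d\}$ be finite partially ordered sets. Then the supporting hyperplanes of the facets of $\Gamma(\mathcal{C}(P),-\mathcal{C}(Q))$ are exactly the hyperplanes $\sum_{p_i\in C}x_i-\sum_{q_j\in C}x_j=1$, where $W$ ranges over subsets of $[d]$ and $C$ ranges over maximal chains of $\Delta_W(P,Q)$. Moreover, the number of facets of $\Gamma(\mathcal{C}(P),-\mathcal{C}(Q))$ equals $\left|\bigcup_{W\subset[d]}\mathcal{M}(\Delta_W(P,Q))\right|$.
   Context: $[d]=\{1,\ldots,d\}$, $\mathbf{e}_i$ unit coordinate vectors. For $I\subset P$, $\rho(I)=\sum_{p_i\in I}\mathbf{e}_i$ (similarly for $Q$). The chain polytope $\mathcal{C}(P)=\mathrm{conv}\{\rho(A): A\text{ antichain of }P\}$ (antichains include $\emptyset$), and $\Gamma(\mathcal{C}(P),-\mathcal{C}(Q))=\mathrm{conv}(\mathcal{C}(P)\cup(-\mathcal{C}(Q)))$. For $W\subset[d]$, $\overline W=[d]\setminus W$, and $\Delta_W(P,Q)$ is the ordinal sum $P_W\oplus Q_{\overline W}$ of the induced subposets $P_W=\{p_i:i\in W\}$ and $Q_{\overline W}=\{q_j:j\in\overline W\}$ (order of $P$ on $P_W$, of $Q$ on $Q_{\overline W}$, every element of $P_W$ below every element of $Q_{\overline W}$). $\mathcal{M}(\Delta_W(P,Q))$ is the set of maximal chains of $\Delta_W(P,Q)$, each regarded as a subset of the symbols $\{p_1,\ldots,p_d,q_1,\ldots,q_d\}$,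 so the union over $W$ identifies equal such subsets arising for different $W$. *)

theory Defs
  imports "HOL-Analysis.Analysis"
begin

text \<open>
  A poset \<open>{p\<^sub>1, \<dots>, p\<^sub>d}\<close> is given by a relation \<open>r\<close> on a finite index type \<open>'n\<close> (playing the
  role of \<open>[d]\<close>, so \<open>d = CARD('n)\<close>) with \<open>partial_order_on UNIV r\<close>; \<open>(i, j) \<in> r\<close> means
  \<open>p\<^sub>i \<le> p\<^sub>j\<close>.
\<close>

definition antichain :: "'a rel \<Rightarrow> 'a set \<Rightarrow> bool"
  where "antichain r A \<longleftrightarrow> (\<forall>x\<in>A. \<forall>y\<in>A. (x, y) \<in> r \<longrightarrow> x = y)"

definition rho :: "'n set \<Rightarrow> real ^ 'n::finite"
  where "rho I = (\<Sum>i\<in>I. axis i 1)"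

definition chain_polytope :: "'n::finite rel \<Rightarrow> (real ^ 'n) set"
  where "chain_polytope r = convex hull {rho A | A. antichain r A}"

definition Gamma_polytope :: "'a::real_vector set \<Rightarrow> 'a set \<Rightarrow> 'a set"
  where "Gamma_polytope S T = convex hull (S \<union> T)"

text \<open>The ordinal sum of \<open>(A, r)\<close> and \<open>(B, s)\<close>, as a relation on the disjoint union \<open>A <+> B\<close>.\<close>
definition ordinal_sum :: "'a set \<Rightarrow> 'a rel \<Rightarrow> 'b set \<Rightarrow> 'b rel \<Rightarrow> ('a + 'b) rel"
  where "ordinal_sum A r B s =
    map_prod Inl Inl ` r \<union> map_prod Inr Inr ` s \<union> (Inl ` A) \<times> (Inr ` B)"

text \<open>The symbols \<open>p\<^sub>i\<close> and \<open>q\<^sub>j\<close> are rendered as \<open>Inl i\<close> and \<open>Inr j\<close>.\<close>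
definition Delta_carrier :: "'n set \<Rightarrow> ('n + 'n) set"
  where "Delta_carrier W = W <+> (- W)"

definition Delta :: "'n set \<Rightarrow> 'n rel \<Rightarrow> 'n rel \<Rightarrow> ('n + 'n) rel"
  where "Delta W P Q = ordinal_sum W (Restr P W) (- W) (Restr Q (- W))"

definition max_chains :: "'a set \<Rightarrow> 'a rel \<Rightarrow> 'a set set"
  where "max_chains A r = {C. pred_on.maxchain A (\<lambda>x y. (x, y) \<in> r) C}"

definition chain_hyperplane :: "('n + 'n) set \<Rightarrow> (real ^ 'n::finite) set"
  where "chain_hyperplane C =
    {x. (\<Sum>i | Inl i \<in> C. x $ i) - (\<Sum>j | Inr j \<in> C. x $ j) = 1}"

definition supporting_hyperplane :: "'a::euclidean_space set \<Rightarrow> 'a set \<Rightarrow> bool"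
  where "supporting_hyperplane S H \<longleftrightarrow>
    (\<exists>a b. a \<noteq> 0 \<and> H = {x. a \<bullet> x = b} \<and> S \<subseteq> {x. a \<bullet> x \<le> b} \<and> S \<inter> H \<noteq> {})"

end

theory Submission
  imports Defs
begin

text \<open>
  For a maximal chain \<open>C\<close> of \<open>\<Delta>\<^sub>W(P, Q)\<close>, the linear form of \<open>C\<close> is at most \<open>1\<close> on the polytope because
  a chain meets an antichain at most once, and maximality provides \<open>d\<close> linearly independent vertices
  at which it equals \<open>1\<close>: a basis vector for each element of \<open>C\<close>, and the sum of two such vectors
  for each other index, which is incomparable to some element of \<open>C\<close>.

  Conversely, let \<open>a \<bullet> x = 1\<close> be the hyperplane of a facet. Its vertices are antichains of \<open>P\<close> of
  maximum weight \<open>1\<close> for the weights \<open>a\<close>, and negatives of antichains of \<open>Q\<close> of maximum weight for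
  \<open>- a\<close>. A weighted Dilworth argument yields a chain of \<open>P\<close> in \<open>{a > 0}\<close> and a chain of \<open>Q\<close> in
  \<open>{a < 0}\<close> meeting all of these, so the vertices, and hence the facet, lie on the hyperplane of
  this pair of chains. An index \<open>k\<close> outside both chains is put into \<open>W\<close> if it occurs in a vertex
  coming from \<open>P\<close>; as the facet is not contained in \<open>x\<^sub>k = 0\<close>, this makes both chains maximal.
\<close>

section \<open>Antichains of maximum weight and chains meeting them all\<close>

lemma antichainD: "antichain r A \<Longrightarrow> x \<in> A \<Longrightarrow> y \<in> A \<Longrightarrow> (x, y) \<in> r \<Longrightarrow> x = y"
  by (auto simp: antichain_def)

lemma antichain_subset: "antichain r A \<Longrightarrow> B \<subseteq> A \<Longrightarrow> antichain r B"
  by (auto simp: antichain_def)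

lemma card_chain_Int_antichain:
  assumes "C \<in> Chains r" "antichain r A"
  shows "card (A \<inter> C) \<le> 1"
proof -
  have "x = y" if "x \<in> A \<inter> C" "y \<in> A \<inter> C" for x y
    using that assms unfolding Chains_def antichain_def by blast
  then show ?thesis
    by (cases "finite (A \<inter> C)") (auto simp: card_le_Suc0_iff_eq)
qed

text \<open>\<open>U\<close> and \<open>L\<close> are the maximal and the minimal elements of
  \<open>A\<close> and \<open>B\<close> taken together. They cover this union, and both contain the
  intersection of \<open>A\<close> and \<open>B\<close>, so their weights add up to at least
  \<open>2 * m\<close>; since neither exceeds \<open>m\<close>, both equal \<open>m\<close>.\<close>

lemma maximal_antichain_exchange:
  fixes w :: "'a \<Rightarrow> real"
  assumes r: "partial_order_on UNIV r" and fin: "finite W"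
    and pos: "\<And>x. x \<in> W \<Longrightarrow> 0 < w x"
    and bound: "\<And>A. A \<subseteq> W \<Longrightarrow> antichain r A \<Longrightarrow> sum w A \<le> m"
    and A: "A \<subseteq> W" "antichain r A" "sum w A = m"
    and B: "B \<subseteq> W" "antichain r B" "sum w B = m"
  defines "U \<equiv> {x \<in> A \<union> B. \<forall>y\<in>A \<union> B. (x, y) \<in> r \<longrightarrow> x = y}"
    and "L \<equiv> {x \<in> A \<union> B. \<forall>y\<in>A \<union> B. (y, x) \<in> r \<longrightarrow> y = x}"
  shows "antichain r U" "sum w U = m" "antichain r L" "sum w L = m"
proof -
  have tr: "trans r" and as: "antisym r"
    using r by (auto simp: partial_order_on_def preorder_on_def)
  have finAB: "finite A" "finite B"
    using A B fin finite_subset by blast+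
  have sub: "U \<subseteq> A \<union> B" "L \<subseteq> A \<union> B"
    by (auto simp: U_def L_def)
  have fins: "finite U" "finite L"
    using sub finAB finite_subset by blast+
  show aU: "antichain r U" and aL: "antichain r L"
    by (auto simp: antichain_def U_def L_def)
  have Un: "U \<union> L = A \<union> B"
  proof -
    \<comment> \<open>Otherwise z < x < y is a chain of three elements in a union of two antichains,
      and two of them lie in the same antichain.\<close>
    have False if x: "x \<in> A \<union> B" "x \<notin> U" "x \<notin> L" for x
    proof -
      obtain y z where yz: "y \<in> A \<union> B" "(x, y) \<in> r" "x \<noteq> y" "z \<in> A \<union> B" "(z, x) \<in> r" "z \<noteq> x"
        using x by (auto simp: U_def L_def)
      have "(z, y) \<in> r" "z \<noteq> y"
        using yz tr as by (meson transD antisymD)+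
      then show False
        using x(1) yz antichainD[OF A(2)] antichainD[OF B(2)] by blast
    qed
    then show ?thesis using sub by blast
  qed
  have Int: "A \<inter> B \<subseteq> U \<inter> L"
    using antichainD[OF A(2)] antichainD[OF B(2)] by (auto simp: U_def L_def)
  have "sum w A + sum w B = sum w (A \<union> B) + sum w (A \<inter> B)"
    using finAB by (simp add: sum.union_inter)
  also have "\<dots> \<le> sum w (U \<union> L) + sum w (U \<inter> L)"
    unfolding Un using Int fins sub A B
    by (intro add_left_mono sum_mono2) (blast intro: less_imp_le pos)+
  also have "\<dots> = sum w U + sum w L"
    using fins by (simp add: sum.union_inter)
  finally have ge: "2 * m \<le> sum w U + sum w L"
    using A B by simp
  have "sum w U \<le> m" "sum w L \<le> m"
    using bound aU aL sub A(1) B(1) by blast+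
  with ge show "sum w U = m" "sum w L = m" by auto
qed

text \<open>
  This is the splitting argument of Perles for Dilworth's theorem. Prescribing an element \<open>x\<close> of
  the chain is what allows to glue the chains obtained above and below a splitting antichain.
\<close>

lemma chain_meeting_maximum_antichains:
  fixes w :: "'a \<Rightarrow> real"
  assumes r: "partial_order_on UNIV r" and "finite W"
    and "\<And>x. x \<in> W \<Longrightarrow> 0 < w x"
    and "\<And>A. A \<subseteq> W \<Longrightarrow> antichain r A \<Longrightarrow> sum w A \<le> m"
    and "x \<in> W"
  shows "\<exists>C\<subseteq>W. x \<in> C \<and> C \<in> Chains r \<and>
    (\<forall>A\<subseteq>W. antichain r A \<and> sum w A = m \<longrightarrow> C \<inter> A \<noteq> {})"
  using assms(2-)
proof (induction "card W" arbitrary: W x rule: less_induct)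
  case less
  note fin = \<open>finite W\<close> and pos = less.prems(2) and bound = less.prems(3) and x = \<open>x \<in> W\<close>
  have rf: "\<And>x. (x, x) \<in> r" and tr: "\<And>x y z. (x, y) \<in> r \<Longrightarrow> (y, z) \<in> r \<Longrightarrow> (x, z) \<in> r"
    and as: "\<And>x y. (x, y) \<in> r \<Longrightarrow> (y, x) \<in> r \<Longrightarrow> x = y"
    using r by (auto simp: partial_order_on_def preorder_on_def refl_on_def dest: transD antisymD)
  have strict: "asymp_on S (\<lambda>x y. (x, y) \<in> r \<and> x \<noteq> y)"
    "transp_on S (\<lambda>x y. (x, y) \<in> r \<and> x \<noteq> y)" for S
    unfolding asymp_on_def transp_on_def using as tr by metis+
  define up where "up A = {z \<in> W. \<exists>a\<in>A. (a, z) \<in> r}" for A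
  define down where "down A = {z \<in> W. \<exists>a\<in>A. (z, a) \<in> r}" for A
  define meets where
    "meets C V \<longleftrightarrow> (\<forall>B\<subseteq>V. antichain r B \<and> sum w B = m \<longrightarrow> C \<inter> B \<noteq> {})" for C V
  \<comment> \<open>Antichains of maximum weight are maximal under inclusion: an element
    incomparable to all of \<open>A\<close> could be added, and its positive weight would exceed the
    bound.\<close>
  have compar: "\<exists>a\<in>A. (a, z) \<in> r \<or> (z, a) \<in> r"
    if A: "A \<subseteq> W" "antichain r A" "sum w A = m" and z: "z \<in> W" for A z
  proof (rule ccontr)
    assume *: "\<not> ?thesis"
    then have "antichain r (insert z A)" "z \<notin> A"
      using A(2) rf by (auto simp: antichain_def)
    then have "w z + sum w A \<le> m"
      using bound[of "insert z A"] A z finite_subset[OF A(1) fin] by auto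
    then show False using pos[OF z] A(3) by simp
  qed
  show ?case
  proof (cases "\<exists>A\<subseteq>W. antichain r A \<and> sum w A = m \<and> up A \<noteq> W \<and> down A \<noteq> W")
    case True
    then obtain A where A: "A \<subseteq> W" "antichain r A" "sum w A = m" "up A \<noteq> W" "down A \<noteq> W"
      by blast
    have UD: "W = up A \<union> down A"
      using compar[OF A(1-3)] by (auto simp: up_def down_def)
    have Asub: "A \<subseteq> up A" "A \<subseteq> down A"
      using A(1) rf by (auto simp: up_def down_def)
    have psub: "up A \<subset> W" "down A \<subset> W"
      using A(4,5) by (auto simp: up_def down_def)
    have chain: "\<exists>C\<subseteq>V. z \<in> C \<and> C \<in> Chains r \<and>
        meets C V"
      if "V \<subset> W" "z \<in> V" for V z
      unfolding meets_def
    proof (rule less.hyps)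
      show "card V < card W" by (rule psubset_card_mono[OF fin that(1)])
      show "finite V" using that(1) fin finite_subset by blast
      show "0 < w x" if "x \<in> V" for x using pos that \<open>V \<subset> W\<close> by blast
      show "sum w A \<le> m" if "A \<subseteq> V" "antichain r A" for A
        using bound that \<open>V \<subset> W\<close> by blast
    qed (rule that(2))
    \<comment> \<open>The chain through \<open>x\<close> exists by induction on the side that
      contains \<open>x\<close>. It meets \<open>A\<close>, which lies on both sides, in some
      \<open>y\<close>; this \<open>y\<close> is then the prescribed element for the chain on the
      other side.\<close>
    have "\<exists>y\<in>A. \<exists>C D. C \<subseteq> up A \<and> D \<subseteq> down A \<and> y \<in> C \<and> y \<in> D \<and> x \<in> C \<union> D
       \<and> C \<in> Chains r \<and> D \<in> Chains r
       \<and> meets C (up A)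
       \<and> meets D (down A)"
    proof (cases "x \<in> up A")
      case True
      obtain C where C: "C \<subseteq> up A" "x \<in> C" "C \<in> Chains r"
        "meets C (up A)"
        using chain[OF psub(1) True] by blast
      obtain y where y: "y \<in> C" "y \<in> A" using C(4) Asub A unfolding meets_def by blast
      then have "y \<in> down A" using Asub by blast
      from chain[OF psub(2) this] C y show ?thesis by blast
    next
      case False
      then have "x \<in> down A" using UD x by blast
      then obtain D where D: "D \<subseteq> down A" "x \<in> D" "D \<in> Chains r"
        "meets D (down A)"
        using chain[OF psub(2)] by blast
      obtain y where y: "y \<in> D" "y \<in> A" using D(4) Asub A unfolding meets_def by blast
      then have "y \<in> up A" using Asub by blast
      from chain[OF psub(1) this] D y show ?thesis by blast
    qed
    then obtain y C D where y: "y \<in> A" "y \<in> C" "y \<in> D" and x: "x \<in> C \<union> D"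
      and C: "C \<subseteq> up A" "C \<in> Chains r" "meets C (up A)"
      and D: "D \<subseteq> down A" "D \<in> Chains r" "meets D (down A)"
      by blast
    \<comment> \<open>An element of \<open>C\<close> lies above some \<open>a\<close> in
      \<open>A\<close>. If it were below \<open>y\<close>, then \<open>a\<close> would be below
      \<open>y\<close>, hence equal to it. So \<open>y\<close> is the bottom of \<open>C\<close>
      and, dually, the top of \<open>D\<close>.\<close>
    have yC: "(y, c) \<in> r" if c: "c \<in> C" for c
    proof -
      obtain a where a: "a \<in> A" "(a, c) \<in> r" using c C(1) by (auto simp: up_def)
      have "(y, c) \<in> r \<or> (c, y) \<in> r" using C(2) c y(2) by (auto simp: Chains_def)
      then show ?thesis using a tr antichainD[OF A(2)] y(1) by blast
    qed
    have yD: "(c, y) \<in> r" if c: "c \<in> D" for c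
    proof -
      obtain a where a: "a \<in> A" "(c, a) \<in> r" using c D(1) by (auto simp: down_def)
      have "(y, c) \<in> r \<or> (c, y) \<in> r" using D(2) c y(3) by (auto simp: Chains_def)
      then show ?thesis using a tr antichainD[OF A(2)] y(1) by blast
    qed
    have "C \<union> D \<in> Chains r"
      using C(2) D(2) tr[OF yD yC] unfolding Chains_def by blast
    \<comment> \<open>\<open>B\<close> may lie on neither side, so it is exchanged with
      \<open>A\<close> for \<open>?U\<close> above \<open>A\<close> and \<open>?L\<close> below
      \<open>A\<close>. If \<open>B\<close> is missed, \<open>C\<close> meets \<open>?U\<close> and
      \<open>D\<close> meets \<open>?L\<close> in points of \<open>A\<close>, which can only be
      \<open>y\<close>. Then \<open>y\<close> is both maximal and minimal in the union of
      \<open>A\<close> and \<open>B\<close>, against \<open>compar\<close> for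
      \<open>B\<close>.\<close>
    moreover have "(C \<union> D) \<inter> B \<noteq> {}" if B: "B \<subseteq> W" "antichain r B" "sum w B = m" for B
    proof
      assume disj: "(C \<union> D) \<inter> B = {}"
      let ?U = "{x \<in> A \<union> B. \<forall>y\<in>A \<union> B. (x, y) \<in> r \<longrightarrow> x = y}"
      let ?L = "{x \<in> A \<union> B. \<forall>y\<in>A \<union> B. (y, x) \<in> r \<longrightarrow> y = x}"
      note ex = maximal_antichain_exchange[OF r fin pos bound A(1-3) B]
      have "x \<in> up A" if u: "x \<in> ?U" for x
      proof -
        have "x \<in> W" using u A(1) B(1) by blast
        moreover obtain a where "a \<in> A" "(a, x) \<in> r \<or> (x, a) \<in> r"
          using compar[OF A(1-3) \<open>x \<in> W\<close>] by blast
        moreover from this have "(a, x) \<in> r" using u rf by blast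
        ultimately show ?thesis by (auto simp: up_def)
      qed
      moreover have "x \<in> down A" if u: "x \<in> ?L" for x
      proof -
        have "x \<in> W" using u A(1) B(1) by blast
        moreover obtain a where "a \<in> A" "(a, x) \<in> r \<or> (x, a) \<in> r"
          using compar[OF A(1-3) \<open>x \<in> W\<close>] by blast
        moreover from this have "(x, a) \<in> r" using u rf by blast
        ultimately show ?thesis by (auto simp: down_def)
      qed
      ultimately have "?U \<subseteq> up A" "?L \<subseteq> down A"
        by blast+
      then have "C \<inter> ?U \<noteq> {}" "D \<inter> ?L \<noteq> {}"
        using C(3) D(3) ex unfolding meets_def by simp_all
      then obtain u l where ul: "u \<in> C" "u \<in> ?U" "l \<in> D" "l \<in> ?L"
        by (meson disjoint_iff)
      have "u \<in> A" "l \<in> A" using ul disj by blast+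
      then have "u = y" "l = y"
        using yC[OF ul(1)] yD[OF ul(3)] antichainD[OF A(2)] y(1) by blast+
      then have "\<forall>b\<in>B. (y, b) \<in> r \<or> (b, y) \<in> r \<longrightarrow> b = y"
        using ul by blast
      moreover have "y \<in> W" using A y by blast
      ultimately show False using compar[OF B, of y] disj y by blast
    qed
    ultimately show ?thesis
      using x C(1) D(1) UD by (intro exI[of _ "C \<union> D"]) blast
  next
    case False
    \<comment> \<open>Each maximum antichain now generates \<open>W\<close> upwards or downwards, so
      it contains all minimal or all maximal elements of \<open>W\<close>. A minimal element below
      \<open>x\<close> and a maximal one above it therefore suffice.\<close>
    have "\<exists>a\<in>{z \<in> W. (z, x) \<in> r}. \<forall>z\<in>{z \<in> W. (z, x) \<in> r}. z \<noteq> a \<longrightarrow> \<not> ((z, a) \<in> r \<and> z \<noteq> a)"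
      by (rule Finite_Set.bex_min_element)
        (use fin x rf strict in auto)
    then obtain a where a: "a \<in> W" "(a, x) \<in> r" "\<And>z. z \<in> W \<Longrightarrow> (z, a) \<in> r \<Longrightarrow> z = a"
      using tr by blast
    have "\<exists>b\<in>{z \<in> W. (x, z) \<in> r}. \<forall>z\<in>{z \<in> W. (x, z) \<in> r}. z \<noteq> b \<longrightarrow> \<not> ((b, z) \<in> r \<and> b \<noteq> z)"
      by (rule Finite_Set.bex_max_element)
        (use fin x rf strict in auto)
    then obtain b where b: "b \<in> W" "(x, b) \<in> r" "\<And>z. z \<in> W \<Longrightarrow> (b, z) \<in> r \<Longrightarrow> z = b"
      using tr by blast
    have "{a, x, b} \<in> Chains r"
      using a b rf tr[OF a(2) b(2)] by (auto simp: Chains_def)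
    moreover have "{a, x, b} \<inter> B \<noteq> {}" if B: "B \<subseteq> W" "antichain r B" "sum w B = m" for B
    proof -
      consider "up B = W" | "down B = W" using False B by blast
      then show ?thesis
      proof cases
        case 1
        then have "a \<in> up B" using a by blast
        then have "a \<in> B" using a(3) B(1) by (auto simp: up_def)
        then show ?thesis by blast
      next
        case 2
        then have "b \<in> down B" using b by blast
        then have "b \<in> B" using b(3) B(1) by (auto simp: down_def)
        then show ?thesis by blast
      qed
    qed
    ultimately show ?thesis
      using a b x by (intro exI[of _ "{a, x, b}"]) blast
  qed
qed

text \<open>Passes to signed weights by working in the set of positive ones. Dropping the other
  elements of an antichain of weight 1 leaves an antichain of weight at least 1, hence exactly 1, so
  no negative weight can occur.\<close>

lemma chain_meeting_tight_antichains:
  fixes u :: "'a::finite \<Rightarrow> real"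
  assumes r: "partial_order_on UNIV r"
    and bound: "\<And>A. antichain r A \<Longrightarrow> sum u A \<le> 1"
  shows "\<exists>C\<in>Chains r. (\<forall>i\<in>C. 0 < u i) \<and>
    (\<forall>A. antichain r A \<and> sum u A = 1 \<longrightarrow> card (A \<inter> C) = 1 \<and> (\<forall>i\<in>A. 0 \<le> u i))"
proof -
  define W where "W = {i. 0 < u i}"
  have "\<exists>C\<subseteq>W. C \<in> Chains r \<and> (\<forall>A\<subseteq>W. antichain r A \<and> sum u A = 1 \<longrightarrow> C \<inter> A \<noteq> {})"
  proof (cases "W = {}")
    case True
    then show ?thesis by (intro exI[of _ "{}"]) (auto simp: Chains_def)
  next
    case False
    then obtain x where "x \<in> W" by blast
    have "\<exists>C\<subseteq>W. x \<in> C \<and> C \<in> Chains r \<and>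
        (\<forall>A\<subseteq>W. antichain r A \<and> sum u A = 1 \<longrightarrow> C \<inter> A \<noteq> {})"
      using chain_meeting_maximum_antichains[OF r finite _ bound \<open>x \<in> W\<close>] by (simp add: W_def)
    then show ?thesis by blast
  qed
  then obtain C where C: "C \<subseteq> W" "C \<in> Chains r"
    and meets: "\<forall>A\<subseteq>W. antichain r A \<and> sum u A = 1 \<longrightarrow> C \<inter> A \<noteq> {}"
    by (elim exE conjE)
  have "card (A \<inter> C) = 1 \<and> (\<forall>i\<in>A. 0 \<le> u i)" if A: "antichain r A" "sum u A = 1" for A
  proof -
    have aW: "antichain r (A \<inter> W)"
      using A(1) antichain_subset by blast
    have split: "sum u A = sum u (A \<inter> W) + sum u (A - W)"
      by (simp add: sum.Int_Diff)
    \<comment> \<open>Stated for supersets of \<open>W\<close> because it is applied to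
      \<open>W\<close> and to \<open>insert i W\<close>.\<close>
    have np: "sum u (A - D) \<le> 0" if "W \<subseteq> D" for D
      by (rule sum_nonpos) (use that in \<open>force simp: W_def not_less[symmetric]\<close>)
    have eq: "sum u (A \<inter> W) = 1" "sum u (A - W) = 0"
      using split np[OF order_refl] bound[OF aW] A(2) by linarith+
    have "0 \<le> u i" if i: "i \<in> A" for i
    proof (rule ccontr)
      assume neg: "\<not> 0 \<le> u i"
      then have "i \<in> A - W" using i by (simp add: W_def)
      then have "sum u (A - W) = u i + sum u (A - W - {i})"
        by (rule sum.remove[OF finite])
      moreover have "A - W - {i} = A - insert i W" by blast
      ultimately show False using eq(2) np[OF subset_insertI, of i] neg by simp
    qed
    moreover have "C \<inter> (A \<inter> W) \<noteq> {}"
      using meets aW eq(1) by simp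
    then have "card (A \<inter> C) \<noteq> 0"
      by auto
    ultimately show ?thesis
      using card_chain_Int_antichain[OF C(2) A(1)] by (intro conjI ballI) linarith+
  qed
  then show ?thesis using C by (intro bexI[of _ C]) (auto simp: W_def)
qed

section \<open>Maximal chains of the ordinal sum\<close>

lemma Delta_simps [simp]:
  "(Inl i, Inl j) \<in> Delta W P Q \<longleftrightarrow> i \<in> W \<and> j \<in> W \<and> (i, j) \<in> P"
  "(Inr i, Inr j) \<in> Delta W P Q \<longleftrightarrow> i \<notin> W \<and> j \<notin> W \<and> (i, j) \<in> Q"
  "(Inl i, Inr j) \<in> Delta W P Q \<longleftrightarrow> i \<in> W \<and> j \<notin> W"
  "(Inr i, Inl j) \<notin> Delta W P Q"
  by (force simp: Delta_def ordinal_sum_def)+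

lemma Delta_carrier_simps [simp]:
  "Inl i \<in> Delta_carrier W \<longleftrightarrow> i \<in> W"
  "Inr i \<in> Delta_carrier W \<longleftrightarrow> i \<notin> W"
  by (auto simp: Delta_carrier_def)

text \<open>Elements of different summands are always comparable, so conditions arise only within
  each summand, and \<open>W\<close> enters through the carrier alone.\<close>

lemma chain_Delta_iff:
  assumes "partial_order_on UNIV P" "partial_order_on UNIV Q"
  shows "pred_on.chain (Delta_carrier W) (\<lambda>x y. (x, y) \<in> Delta W P Q) C \<longleftrightarrow>
    C \<subseteq> Delta_carrier W \<and> Inl -` C \<in> Chains P \<and> Inr -` C \<in> Chains Q"
    (is "?l \<longleftrightarrow> ?r")
proof
  have rf: "\<And>x. (x, x) \<in> P" "\<And>x. (x, x) \<in> Q"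
    using assms by (auto simp: partial_order_on_def preorder_on_def refl_on_def)
  show ?r if l: ?l
  proof -
    have sub: "C \<subseteq> Delta_carrier W" and
      ch: "\<And>x y. x \<in> C \<Longrightarrow> y \<in> C \<Longrightarrow> x = y \<or> (x, y) \<in> Delta W P Q \<or> (y, x) \<in> Delta W P Q"
      using l by (auto simp: pred_on.chain_def)
    have "(i, j) \<in> P \<or> (j, i) \<in> P" if "Inl i \<in> C" "Inl j \<in> C" for i j
      using ch[OF that] rf by auto
    moreover have "(i, j) \<in> Q \<or> (j, i) \<in> Q" if "Inr i \<in> C" "Inr j \<in> C" for i j
      using ch[OF that] rf by auto
    ultimately show ?thesis using sub by (simp add: Chains_def)
  qed
  show ?l if r: ?r
    unfolding pred_on.chain_def
  proof (intro conjI ballI)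
    show "C \<subseteq> Delta_carrier W" using r by blast
    fix x y assume xy: "x \<in> C" "y \<in> C"
    then have "x \<in> Delta_carrier W" "y \<in> Delta_carrier W" using r by blast+
    moreover have "(i, j) \<in> P \<or> (j, i) \<in> P" if "Inl i \<in> C" "Inl j \<in> C" for i j
      using that r by (simp add: Chains_def)
    moreover have "(i, j) \<in> Q \<or> (j, i) \<in> Q" if "Inr i \<in> C" "Inr j \<in> C" for i j
      using that r by (simp add: Chains_def)
    ultimately show "(\<lambda>x y. (x, y) \<in> Delta W P Q)\<^sup>=\<^sup>= x y \<or> (\<lambda>x y. (x, y) \<in> Delta W P Q)\<^sup>=\<^sup>= y x"
      using xy by (cases x; cases y) auto
  qed
qed

lemma vimage_insert_Inl_Inr:
  "Inl -` insert (Inl k) C = insert k (Inl -` C)" "Inr -` insert (Inl k) C = Inr -` C"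
  "Inr -` insert (Inr k) C = insert k (Inr -` C)" "Inl -` insert (Inr k) C = Inl -` C"
  by auto

lemma insert_Chains_iff:
  assumes "(k, k) \<in> r" "C \<in> Chains r"
  shows "insert k C \<in> Chains r \<longleftrightarrow> (\<forall>i\<in>C. (i, k) \<in> r \<or> (k, i) \<in> r)"
  using assms by (auto simp: Chains_def)

text \<open>Subsets of chains are chains, so maximality can be tested by adding one element. Each
  obstruction is an incomparable pair in \<open>P\<close> or in \<open>Q\<close>, that is, a
  two-element antichain, which is the form used for facets.\<close>

lemma max_chains_Delta_iff:
  assumes P: "partial_order_on UNIV P" and Q: "partial_order_on UNIV Q"
  shows "C \<in> max_chains (Delta_carrier W) (Delta W P Q) \<longleftrightarrow>
    C \<subseteq> Delta_carrier W \<and> Inl -` C \<in> Chains P \<and> Inr -` C \<in> Chains Q \<and>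
    (\<forall>k\<in>W. Inl k \<notin> C \<longrightarrow> (\<exists>i. Inl i \<in> C \<and> (i, k) \<notin> P \<and> (k, i) \<notin> P)) \<and>
    (\<forall>k\<in>- W. Inr k \<notin> C \<longrightarrow> (\<exists>i. Inr i \<in> C \<and> (i, k) \<notin> Q \<and> (k, i) \<notin> Q))"
proof -
  have rf: "\<And>x. (x, x) \<in> P" "\<And>x. (x, x) \<in> Q"
    using assms by (auto simp: partial_order_on_def preorder_on_def refl_on_def)
  let ?ch = "pred_on.chain (Delta_carrier W) (\<lambda>x y. (x, y) \<in> Delta W P Q)"
  have sub: "?ch D" if "?ch E" "D \<subseteq> E" for D E
    using that unfolding pred_on.chain_def by (meson order_trans subsetD)
  have "(\<exists>D. ?ch D \<and> C \<subset> D) \<longleftrightarrow> (\<exists>x. x \<notin> C \<and> ?ch (insert x C))"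
  proof
    assume "\<exists>D. ?ch D \<and> C \<subset> D"
    then obtain D where D: "?ch D" "C \<subset> D" by (elim exE conjE)
    then obtain x where "insert x C \<subseteq> D" "x \<notin> C" by (metis insert_subset psubset_imp_ex_mem psubset_imp_subset DiffE)
    then show "\<exists>x. x \<notin> C \<and> ?ch (insert x C)"
      using sub[OF D(1), of "insert x C"] by (intro exI[of _ x] conjI)
  next
    assume "\<exists>x. x \<notin> C \<and> ?ch (insert x C)"
    then obtain x where "x \<notin> C" "?ch (insert x C)" by (elim exE conjE)
    then show "\<exists>D. ?ch D \<and> C \<subset> D"
      by (intro exI[of _ "insert x C"]) auto
  qed
  then have eq: "C \<in> max_chains (Delta_carrier W) (Delta W P Q) \<longleftrightarrow>
      ?ch C \<and> \<not> (\<exists>x. x \<notin> C \<and> ?ch (insert x C))"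
    by (simp only: max_chains_def pred_on.maxchain_def mem_Collect_eq)
  show ?thesis
  proof (cases "?ch C")
    case True
    then have C: "C \<subseteq> Delta_carrier W" "Inl -` C \<in> Chains P" "Inr -` C \<in> Chains Q"
      by (simp_all add: chain_Delta_iff[OF assms])
    have "?ch (insert (Inl k) C) \<longleftrightarrow> k \<in> W \<and> (\<forall>i. Inl i \<in> C \<longrightarrow> (i, k) \<in> P \<or> (k, i) \<in> P)" for k
      using C by (simp add: chain_Delta_iff[OF assms] vimage_insert_Inl_Inr insert_Chains_iff rf Ball_def)
    moreover have "?ch (insert (Inr k) C) \<longleftrightarrow> k \<notin> W \<and> (\<forall>i. Inr i \<in> C \<longrightarrow> (i, k) \<in> Q \<or> (k, i) \<in> Q)" for k
      using C by (simp add: chain_Delta_iff[OF assms] vimage_insert_Inl_Inr insert_Chains_iff rf Ball_def)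
    ultimately show ?thesis
      unfolding eq split_sum_ex using True C by (simp only: simp_thms Ball_def Compl_iff) blast
  next
    case False
    then show ?thesis unfolding eq by (auto simp: chain_Delta_iff[OF assms])
  qed
qed

section \<open>Linear forms of chains and generators of the polytope\<close>

definition chain_normal :: "('n + 'n) set \<Rightarrow> real ^ 'n::finite"
  where "chain_normal C = (\<chi> i. of_bool (Inl i \<in> C) - of_bool (Inr i \<in> C))"

lemma inner_rho: "w \<bullet> rho A = (\<Sum>i\<in>A. w $ i)"
  by (simp add: rho_def inner_sum_right inner_axis)

lemma rho_nth: "rho A $ i = of_bool (i \<in> A)"
  by (simp add: rho_def axis_def)

lemma chain_hyperplane_eq: "chain_hyperplane C = {x. chain_normal C \<bullet> x = 1}"
proof -
  have "chain_normal C \<bullet> x = (\<Sum>i | Inl i \<in> C. x $ i) - (\<Sum>j | Inr j \<in> C. x $ j)" for x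
    by (simp add: chain_normal_def inner_vec_def left_diff_distrib sum_subtractf)
  then show ?thesis by (simp add: chain_hyperplane_def)
qed

lemma chain_normal_rho:
  "chain_normal C \<bullet> rho A = real (card (A \<inter> Inl -` C)) - real (card (A \<inter> Inr -` C))"
  by (simp add: inner_rho chain_normal_def sum_subtractf vimage_def)

text \<open>A finite generating set, slightly larger than the set of vertices: the empty antichain
  contributes the interior point 0.\<close>

definition Gamma_vertices :: "'n::finite rel \<Rightarrow> 'n rel \<Rightarrow> (real ^ 'n) set"
  where "Gamma_vertices P Q = {rho A |A. antichain P A} \<union> {- rho B |B. antichain Q B}"

lemma Gamma_polytope_eq:
  "Gamma_polytope (chain_polytope P) (uminus ` chain_polytope Q) = convex hull (Gamma_vertices P Q)"
proof -
  have "uminus ` chain_polytope Q = convex hull (uminus ` {rho B |B. antichain Q B})"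
    unfolding chain_polytope_def
    by (rule convex_hull_linear_image) (rule linear_uminus)
  also have "uminus ` {rho B |B. antichain Q B} = {- rho B |B. antichain Q B}"
    by auto
  finally show ?thesis
    unfolding Gamma_polytope_def Gamma_vertices_def chain_polytope_def
    by (simp add: hull_Un_left[symmetric] hull_Un_right[symmetric])
qed

lemma finite_Gamma_vertices: "finite (Gamma_vertices P Q)"
proof -
  have "Gamma_vertices P Q \<subseteq> range rho \<union> range (\<lambda>B. - rho B)"
    by (auto simp: Gamma_vertices_def)
  then show ?thesis by (rule finite_subset) simp
qed

lemma axis_in_Gamma_vertices:
  "axis i 1 \<in> Gamma_vertices P Q" "- axis i 1 \<in> Gamma_vertices P Q"
proof -
  have "axis i 1 = (rho {i} :: real ^ 'a)" by (simp add: rho_def)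
  moreover have "antichain P {i}" "antichain Q {i}" by (auto simp: antichain_def)
  ultimately show "axis i 1 \<in> Gamma_vertices P Q" "- axis i 1 \<in> Gamma_vertices P Q"
    unfolding Gamma_vertices_def by auto
qed

lemma zero_in_Gamma_vertices: "0 \<in> Gamma_vertices P Q"
  unfolding Gamma_vertices_def
  by (rule UnI1, rule CollectI, rule exI[of _ "{}"]) (simp add: rho_def antichain_def)

lemma span_axes_UNIV:
  fixes S :: "(real ^ 'n) set"
  assumes "\<And>i. axis i 1 \<in> span S"
  shows "span S = UNIV"
proof -
  have "Basis \<subseteq> span S" using assms by (auto simp: Basis_vec_def)
  then have "span Basis \<subseteq> span S" by (rule span_minimal) (rule subspace_span)
  then show ?thesis by (metis span_Basis top.extremum_uniqueI)
qed

lemma aff_dim_spanning_zero: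
  fixes S :: "'a::euclidean_space set"
  assumes "span S = UNIV" "0 \<in> S"
  shows "aff_dim S = DIM('a)"
  using assms by (metis aff_dim_zero dim_UNIV dim_span hull_inc)

lemma aff_dim_Gamma: "aff_dim (convex hull (Gamma_vertices P Q :: (real ^ 'n) set)) = CARD('n)"
proof -
  have "span (Gamma_vertices P Q :: (real ^ 'n) set) = UNIV"
    by (rule span_axes_UNIV) (simp add: axis_in_Gamma_vertices span_base)
  then show ?thesis
    using aff_dim_spanning_zero[OF _ zero_in_Gamma_vertices] by (simp add: aff_dim_convex_hull)
qed

section \<open>Facets of convex hulls and their hyperplanes\<close>

lemma convex_hull_subset_halfspace:
  assumes "\<And>v. v \<in> S \<Longrightarrow> a \<bullet> v \<le> b"
  shows "convex hull S \<subseteq> {x. a \<bullet> x \<le> b}"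
  by (rule hull_minimal) (use assms in \<open>auto simp: convex_halfspace_le\<close>)

text \<open>The hyperplane avoids 0, so adding 0 to the face raises its affine dimension by exactly
  one. As the face spans the whole space linearly, it has codimension one.\<close>

lemma facet_of_convex_hull_hyperplane:
  fixes S :: "'a::euclidean_space set"
  assumes le: "\<And>v. v \<in> S \<Longrightarrow> c \<bullet> v \<le> 1" and "0 \<in> S"
    and span: "span (S \<inter> {x. c \<bullet> x = 1}) = UNIV"
  shows "(convex hull S \<inter> {x. c \<bullet> x = 1}) facet_of convex hull S"
proof -
  define F where "F = convex hull S \<inter> {x. c \<bullet> x = 1}"
  have sub: "S \<inter> {x. c \<bullet> x = 1} \<subseteq> F"
    using hull_subset[of S convex] by (auto simp: F_def)
  have spanF: "span F = UNIV"
    using span_mono[OF sub] span by auto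
  have "affine hull F \<subseteq> {x. c \<bullet> x = 1}"
    by (rule hull_minimal) (auto simp: F_def affine_hyperplane)
  then have "0 \<notin> affine hull F" by auto
  moreover have "aff_dim (insert 0 F) = DIM('a)"
    by (rule aff_dim_spanning_zero) (use spanF in auto)
  ultimately have dF: "aff_dim F = DIM('a) - 1"
    by (simp add: aff_dim_insert)
  have "span (convex hull S) = UNIV"
    using spanF span_mono[of F "convex hull S"] by (auto simp: F_def)
  then have "aff_dim (convex hull S) = DIM('a)"
    by (rule aff_dim_spanning_zero) (use \<open>0 \<in> S\<close> in \<open>simp add: hull_inc\<close>)
  moreover have "F face_of convex hull S"
    unfolding F_def using convex_hull_subset_halfspace[of S c 1, OF le]
    by (intro face_of_Int_supporting_hyperplane_le) auto
  \<comment> \<open>The space has dimension at least 1, so \<open>aff_dim F\<close> is at least 0,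
    whereas the empty set has affine dimension -1.\<close>
  moreover have "F \<noteq> {}"
    using dF DIM_positive[where 'a='a] aff_dim_empty_eq[where 'a='a] by force
  ultimately show ?thesis
    using dF by (simp add: facet_of_def F_def)
qed

text \<open>A face of the hull is the hull of some of the generators, so those on the hyperplane
  already have its dimension. Hence the hyperplane of a facet is determined by the generators on
  it.\<close>

lemma affine_hull_facet_vertices:
  fixes S :: "'a::euclidean_space set"
  assumes "finite S" "aff_dim (convex hull S) = DIM('a)" "a \<noteq> 0"
    and F: "(convex hull S \<inter> {x. a \<bullet> x = b}) facet_of convex hull S"
  shows "affine hull (S \<inter> {x. a \<bullet> x = b}) = {x. a \<bullet> x = b}"
proof -
  let ?H = "{x. a \<bullet> x = b}"
  obtain T where T: "T \<subseteq> S" "convex hull S \<inter> ?H = convex hull T"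
    using face_of_convex_hull_subset[OF finite_imp_compact[OF assms(1)] facet_of_imp_face_of[OF F]]
    by blast
  have "T \<subseteq> S \<inter> ?H"
    using T hull_subset[of T convex] by blast
  then have "aff_dim T \<le> aff_dim (S \<inter> ?H)"
    by (rule aff_dim_subset)
  moreover have "aff_dim T = DIM('a) - 1"
    using F T(2) assms(2) by (simp add: facet_of_def aff_dim_convex_hull)
  ultimately have "aff_dim ?H \<le> aff_dim (S \<inter> ?H)"
    using assms(3) by simp
  moreover have sub: "affine hull (S \<inter> ?H) \<subseteq> affine hull ?H"
    by (rule hull_mono) auto
  ultimately have "affine hull (S \<inter> ?H) = affine hull ?H"
    using aff_dim_psubset[of "S \<inter> ?H" ?H] by force
  then show ?thesis by (simp add: affine_hyperplane)
qed

section \<open>Maximal chains give facets, and facets give maximal chains\<close>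

text \<open>On \<open>rho A\<close> the \<open>Q\<close> part of \<open>C\<close> only lowers the
  value, and the \<open>P\<close> part meets \<open>A\<close> at most once; on negatives the roles
  are exchanged.\<close>

lemma chain_normal_le_1:
  assumes C: "Inl -` C \<in> Chains P" "Inr -` C \<in> Chains Q" and v: "v \<in> Gamma_vertices P Q"
  shows "chain_normal C \<bullet> v \<le> 1"
proof -
  have "chain_normal C \<bullet> rho A \<le> 1" if "antichain P A" for A
    using card_chain_Int_antichain[OF C(1) that] by (simp add: chain_normal_rho)
  moreover have "chain_normal C \<bullet> (- rho A) \<le> 1" if "antichain Q A" for A
    using card_chain_Int_antichain[OF C(2) that] by (simp add: chain_normal_rho)
  ultimately show ?thesis
    using v by (auto simp: Gamma_vertices_def)
qed

lemma chain_hyperplane_facet: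
  fixes P Q :: "'n::finite rel"
  assumes P: "partial_order_on UNIV P" and Q: "partial_order_on UNIV Q"
    and C: "C \<in> max_chains (Delta_carrier W) (Delta W P Q)"
  shows "(convex hull (Gamma_vertices P Q) \<inter> chain_hyperplane C) facet_of
    convex hull (Gamma_vertices P Q)"
proof -
  note C' = C[unfolded max_chains_Delta_iff[OF P Q]]
  let ?V = "Gamma_vertices P Q" and ?H = "{x. chain_normal C \<bullet> x = 1}"
  \<comment> \<open>No index occurs in \<open>C\<close> on both sides, so nothing cancels in
    \<open>chain_normal C\<close>.\<close>
  have disj: "Inl k \<in> C \<longleftrightarrow> k \<in> W \<and> Inl k \<in> C" "Inr k \<in> C \<longleftrightarrow> k \<notin> W \<and> Inr k \<in> C" for k
    using C' by auto
  have L: "axis i 1 \<in> ?V \<inter> ?H" if "Inl i \<in> C" for i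
    using that disj[of i] by (auto simp: axis_in_Gamma_vertices inner_axis chain_normal_def)
  have R: "- axis i 1 \<in> ?V \<inter> ?H" if "Inr i \<in> C" for i
    using that disj[of i] by (auto simp: axis_in_Gamma_vertices inner_axis chain_normal_def)
  have "axis k 1 \<in> span (?V \<inter> ?H)" for k
  proof -
    consider "Inl k \<in> C" | "Inr k \<in> C" | "k \<in> W" "Inl k \<notin> C" "Inr k \<notin> C"
      | "k \<notin> W" "Inl k \<notin> C" "Inr k \<notin> C" by blast
    then show ?thesis
    proof cases
      case 1
      from L[OF this] show ?thesis by (rule span_base)
    next
      case 2
      from span_neg[OF span_base[OF R[OF this]]] show ?thesis by simp
    next
      \<comment> \<open>Maximality yields \<open>i\<close> in the chain incomparable to
        \<open>k\<close>. Then \<open>rho {i, k}\<close> lies on the hyperplane, and subtracting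
        \<open>axis i 1\<close> leaves \<open>axis k 1\<close>.\<close>
      case 3
      then obtain i where i: "Inl i \<in> C" "(i, k) \<notin> P" "(k, i) \<notin> P"
        using C' by blast
      then have "antichain P {i, k}" "i \<noteq> k"
        using 3 by (auto simp: antichain_def)
      moreover have "rho {i, k} = axis i 1 + (axis k 1 :: real ^ 'n)"
        using \<open>i \<noteq> k\<close> by (simp add: rho_def)
      ultimately have "axis i 1 + axis k 1 \<in> ?V"
        unfolding Gamma_vertices_def by force
      moreover have "Inr i \<notin> C" using i disj[of i] by blast
      then have "axis i 1 + axis k 1 \<in> ?H"
        using i 3 by (simp add: inner_right_distrib inner_axis chain_normal_def)
      ultimately have "axis i 1 + axis k 1 \<in> ?V \<inter> ?H" by (rule IntI)
      from span_diff[OF span_base[OF this] span_base[OF L[OF i(1)]]] show ?thesis by simp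
    next
      case 4
      then obtain i where i: "Inr i \<in> C" "(i, k) \<notin> Q" "(k, i) \<notin> Q"
        using C' by blast
      then have "antichain Q {i, k}" "i \<noteq> k"
        using 4 by (auto simp: antichain_def)
      moreover have "rho {i, k} = axis i 1 + (axis k 1 :: real ^ 'n)"
        using \<open>i \<noteq> k\<close> by (simp add: rho_def)
      ultimately have "- (axis i 1 + axis k 1) \<in> ?V"
        unfolding Gamma_vertices_def by force
      moreover have "Inl i \<notin> C" using i disj[of i] by blast
      then have "- (axis i 1 + axis k 1) \<in> ?H"
        using i 4 by (simp add: inner_right_distrib inner_diff_right inner_axis chain_normal_def)
      ultimately have "- (axis i 1 + axis k 1) \<in> ?V \<inter> ?H" by (rule IntI)
      from span_diff[OF span_base[OF R[OF i(1)]] span_base[OF this]] show ?thesis by simp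
    qed
  qed
  then have "span (?V \<inter> ?H) = UNIV" by (rule span_axes_UNIV)
  then show ?thesis
    unfolding chain_hyperplane_eq
    using chain_normal_le_1 C' by (intro facet_of_convex_hull_hyperplane)
      (auto simp: zero_in_Gamma_vertices)
qed

lemma facet_hyperplane_is_chain_hyperplane:
  fixes P Q :: "'n::finite rel"
  assumes P: "partial_order_on UNIV P" and Q: "partial_order_on UNIV Q"
    and "a \<noteq> 0"
    and sub: "convex hull (Gamma_vertices P Q) \<subseteq> {x. a \<bullet> x \<le> b}"
    and F: "(convex hull (Gamma_vertices P Q) \<inter> {x. a \<bullet> x = b}) facet_of
      convex hull (Gamma_vertices P Q)"
  obtains W C where "C \<in> max_chains (Delta_carrier W) (Delta W P Q)"
    "{x. a \<bullet> x = b} = chain_hyperplane C"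
proof -
  let ?V = "Gamma_vertices P Q"
  define H where "H = {x. a \<bullet> x = b}"
  define U where "U = ?V \<inter> H"
  have aff: "affine hull U = H"
    unfolding U_def H_def
    using affine_hull_facet_vertices[OF finite_Gamma_vertices _ \<open>a \<noteq> 0\<close> F]
    by (simp add: aff_dim_Gamma)
  have Vle: "a \<bullet> v \<le> b" if "v \<in> ?V" for v
    using that sub hull_subset[of ?V convex] by blast
  have coord: "\<bar>a $ i\<bar> \<le> b" for i
    using Vle[OF axis_in_Gamma_vertices(1)[of i]] Vle[OF axis_in_Gamma_vertices(2)[of i]]
    by (simp add: inner_axis)
  \<comment> \<open>The generators \<open>axis i 1\<close> and \<open>- axis i 1\<close> bound every
    coordinate of \<open>a\<close> by \<open>b\<close> in absolute value, and \<open>a\<close> is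
    nonzero. This allows normalising the right-hand side to 1.\<close>
  have "b > 0"
  proof (rule ccontr)
    assume "\<not> 0 < b"
    then have "a $ i = 0" for i using coord[of i] by linarith
    with \<open>a \<noteq> 0\<close> show False by (simp add: vec_eq_iff)
  qed
  define u where "u i = a $ i / b" for i
  have sum_u: "sum u A = (a \<bullet> rho A) / b" for A
    by (simp add: u_def inner_rho sum_divide_distrib)
  have Pb: "sum u A \<le> 1" if "antichain P A" for A
    using Vle[of "rho A"] that \<open>b > 0\<close> by (auto simp: sum_u Gamma_vertices_def)
  have Qb: "sum (\<lambda>i. - u i) B \<le> 1" if "antichain Q B" for B
  proof -
    have "- rho B \<in> ?V" using that by (auto simp: Gamma_vertices_def)
    from Vle[OF this] show ?thesis
      using \<open>b > 0\<close> by (simp add: sum_negf sum_u field_simps)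
  qed
  obtain C1 where C1: "C1 \<in> Chains P" "\<And>i. i \<in> C1 \<Longrightarrow> 0 < u i"
    "\<And>A. antichain P A \<Longrightarrow> sum u A = 1 \<Longrightarrow> card (A \<inter> C1) = 1 \<and> (\<forall>i\<in>A. 0 \<le> u i)"
    using chain_meeting_tight_antichains[OF P Pb] by auto
  obtain C2 where C2: "C2 \<in> Chains Q" "\<And>i. i \<in> C2 \<Longrightarrow> u i < 0"
    "\<And>B. antichain Q B \<Longrightarrow> sum (\<lambda>i. - u i) B = 1 \<Longrightarrow> card (B \<inter> C2) = 1 \<and> (\<forall>i\<in>B. u i \<le> 0)"
    using chain_meeting_tight_antichains[OF Q Qb] by auto
  define C where "C = C1 <+> C2"
  have vim: "Inl -` C = C1" "Inr -` C = C2" and mem: "\<And>i. Inl i \<in> C \<longleftrightarrow> i \<in> C1" "\<And>i. Inr i \<in> C \<longleftrightarrow> i \<in> C2"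
    by (auto simp: C_def)
  have "chain_normal C \<bullet> v = 1" if v: "v \<in> U" for v
  proof -
    have "v \<in> ?V" "a \<bullet> v = b" using v by (auto simp: U_def H_def)
    then consider A where "antichain P A" "v = rho A" "sum u A = 1"
      | B where "antichain Q B" "v = - rho B" "sum (\<lambda>i. - u i) B = 1"
      using \<open>b > 0\<close> by (fastforce simp: Gamma_vertices_def sum_u sum_negf)
    then show ?thesis
    proof cases
      case 1
      \<comment> \<open>A tight antichain of \<open>P\<close> carries only nonnegative weights,
        while those on \<open>C2\<close> are negative.\<close>
      have "A \<inter> C2 = {}" using C1(3)[OF 1(1,3)] C2(2) by fastforce
      then show ?thesis using C1(3)[OF 1(1,3)] 1(2) by (simp add: chain_normal_rho vim)
    next
      case 2
      have "B \<inter> C1 = {}" using C2(3)[OF 2(1,3)] C1(2) by fastforce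
      then show ?thesis using C2(3)[OF 2(1,3)] 2(2) by (simp add: chain_normal_rho vim)
    qed
  qed
  then have "affine hull U \<subseteq> chain_hyperplane C"
    unfolding chain_hyperplane_eq by (intro hull_minimal) (auto simp: affine_hyperplane)
  then have Hsub: "H \<subseteq> chain_hyperplane C" by (simp add: aff)
  have Hne: "H \<noteq> {}" using \<open>a \<noteq> 0\<close> hyperplane_eq_empty[of a b] unfolding H_def by blast
  then have n0: "chain_normal C \<noteq> 0" using Hsub by (auto simp: chain_hyperplane_eq)
  \<comment> \<open>Both sides are hyperplanes, so the inclusion between them is an
    equality.\<close>
  have HC: "H = chain_hyperplane C"
    by (rule affine_dim_equal)
      (use Hsub Hne n0 \<open>a \<noteq> 0\<close> in \<open>auto simp: H_def chain_hyperplane_eq affine_hyperplane\<close>)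
  \<comment> \<open>An index off both chains goes to a side where a tight antichain contains it:
    that antichain meets the chain of its side in an element incomparable to the index.\<close>
  define W where "W = {k. k \<in> C1 \<or> k \<notin> C2 \<and> (\<exists>A. antichain P A \<and> rho A \<in> H \<and> k \<in> A)}"
  have disj: "k \<notin> C2" if "k \<in> C1" for k using C1(2)[OF that] C2(2)[of k] by linarith
  have "\<exists>i. i \<in> C1 \<and> (i, k) \<notin> P \<and> (k, i) \<notin> P" if k: "k \<in> W" "k \<notin> C1" for k
  proof -
    obtain A where A: "antichain P A" "rho A \<in> H" "k \<in> A" using k by (auto simp: W_def)
    then have "real (card (A \<inter> C1)) - real (card (A \<inter> C2)) = 1"
      by (simp add: HC chain_hyperplane_eq chain_normal_rho vim)
    then have "card (A \<inter> C1) \<noteq> 0" by linarith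
    then obtain i where "i \<in> A" "i \<in> C1" by (auto simp: card_eq_0_iff)
    then show ?thesis using A k by (metis antichainD)
  qed
  moreover have "\<exists>i. i \<in> C2 \<and> (i, k) \<notin> Q \<and> (k, i) \<notin> Q" if k: "k \<notin> W" "k \<notin> C2" for k
  proof -
    have "k \<notin> C1" using k by (simp add: W_def)
    \<comment> \<open>If all generators on \<open>H\<close> vanished at \<open>k\<close>, so would
      \<open>H\<close>; but \<open>k\<close> is off both chains, so \<open>H\<close> is invariant
      under translation by \<open>axis k 1\<close>. A generator with nonzero entry at
      \<open>k\<close> cannot come from \<open>P\<close>, since \<open>k\<close> is not in
      \<open>W\<close>.\<close>
    have "\<exists>v\<in>U. v $ k \<noteq> 0"
    proof (rule ccontr)
      assume "\<not> ?thesis"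
      then have "affine hull U \<subseteq> {x. axis k 1 \<bullet> x = 0}"
        by (intro hull_minimal affine_hyperplane) (auto simp: inner_axis')
      then have z: "x $ k = 0" if "x \<in> H" for x
        using that by (auto simp: aff inner_axis')
      obtain x where x: "x \<in> H" using Hne by blast
      then have "x + axis k 1 \<in> H"
        using k \<open>k \<notin> C1\<close> by (simp add: HC chain_hyperplane_eq inner_right_distrib inner_axis
            chain_normal_def mem)
      from z[OF this] z[OF x] show False by simp
    qed
    then obtain v where v: "v \<in> ?V" "v \<in> H" "v $ k \<noteq> 0" by (auto simp: U_def)
    then obtain B where B: "antichain Q B" "v = - rho B" "k \<in> B"
      using k \<open>k \<notin> C1\<close> by (fastforce simp: Gamma_vertices_def W_def rho_nth split: if_splits)
    then have "real (card (B \<inter> C2)) - real (card (B \<inter> C1)) = 1"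
      using v(2) by (simp add: HC chain_hyperplane_eq chain_normal_rho vim)
    then have "card (B \<inter> C2) \<noteq> 0" by linarith
    then obtain i where "i \<in> B" "i \<in> C2" by (auto simp: card_eq_0_iff)
    then show ?thesis using B k by (metis antichainD)
  qed
  moreover have "C \<subseteq> Delta_carrier W"
    using disj by (auto simp: C_def Delta_carrier_def W_def)
  ultimately have "C \<in> max_chains (Delta_carrier W) (Delta W P Q)"
    unfolding max_chains_Delta_iff[OF P Q] vim mem using C1(1) C2(1) by blast
  then show thesis using that HC by (simp add: H_def)
qed

section \<open>The bijection between maximal chains and facets\<close>

text \<open>The face determines the chain, whatever the sets \<open>W\<close> and \<open>W'\<close>:
  \<open>Inl i\<close> is in \<open>C\<close> exactly when \<open>axis i 1\<close> is on the
  hyperplane, and \<open>Inr i\<close> exactly when \<open>- axis i 1\<close> is. Both points belong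
  to the polytope.\<close>

lemma chain_hyperplane_Gamma_inj:
  assumes "C \<subseteq> Delta_carrier W" "C' \<subseteq> Delta_carrier W'"
    and eq: "convex hull (Gamma_vertices P Q) \<inter> chain_hyperplane C =
      convex hull (Gamma_vertices P Q) \<inter> chain_hyperplane C'"
  shows "C = C'"
proof -
  have disj: "\<not> (Inl i \<in> C \<and> Inr i \<in> C)" "\<not> (Inl i \<in> C' \<and> Inr i \<in> C')" for i
    using assms(1,2) Delta_carrier_simps by (metis subsetD)+
  have *: "v \<in> chain_hyperplane C \<longleftrightarrow> v \<in> chain_hyperplane C'" if "v \<in> Gamma_vertices P Q" for v
  proof -
    have "v \<in> convex hull (Gamma_vertices P Q)" using that by (rule hull_inc)
    then show ?thesis using eq by (metis IntD2 IntI)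
  qed
  have "chain_normal D \<bullet> axis i 1 = 1 \<longleftrightarrow> Inl i \<in> D \<and> Inr i \<notin> D"
    "chain_normal D \<bullet> (- axis i 1) = 1 \<longleftrightarrow> Inr i \<in> D \<and> Inl i \<notin> D" for D and i :: 'a
    by (simp_all add: inner_axis chain_normal_def)
  then have "Inl i \<in> C \<longleftrightarrow> Inl i \<in> C'" "Inr i \<in> C \<longleftrightarrow> Inr i \<in> C'" for i
    using *[OF axis_in_Gamma_vertices(1)[of i]] *[OF axis_in_Gamma_vertices(2)[of i]] disj[of i]
    unfolding chain_hyperplane_eq mem_Collect_eq by metis+
  then have "x \<in> C \<longleftrightarrow> x \<in> C'" for x
    by (cases x) simp_all
  then show ?thesis by blast
qed

theorem theorem2p2:
  fixes P Q :: "'n::finite rel"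
  assumes "partial_order_on UNIV P" and "partial_order_on UNIV Q"
  shows "{H. \<exists>F. F facet_of Gamma_polytope (chain_polytope P) (uminus ` chain_polytope Q)
               \<and> supporting_hyperplane (Gamma_polytope (chain_polytope P) (uminus ` chain_polytope Q)) H
               \<and> Gamma_polytope (chain_polytope P) (uminus ` chain_polytope Q) \<inter> H = F}
       = {chain_hyperplane C | W C. C \<in> max_chains (Delta_carrier W) (Delta W P Q)}
     \<and> card {F. F facet_of Gamma_polytope (chain_polytope P) (uminus ` chain_polytope Q)}
       = card (\<Union>W. max_chains (Delta_carrier W) (Delta W P Q))"
proof -
  define G where "G = convex hull (Gamma_vertices P Q)"
  let ?M = "\<Union>W. max_chains (Delta_carrier W) (Delta W P Q)"
  have facet: "(G \<inter> chain_hyperplane C) facet_of G" if "C \<in> ?M" for C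
    using that unfolding G_def by (elim UN_E) (rule chain_hyperplane_facet[OF assms])
  have chain: "\<exists>C\<in>?M. {x. a \<bullet> x = b} = chain_hyperplane C"
    if "a \<noteq> 0" "G \<subseteq> {x. a \<bullet> x \<le> b}" "(G \<inter> {x. a \<bullet> x = b}) facet_of G" for a b
    by (rule facet_hyperplane_is_chain_hyperplane[OF assms that[unfolded G_def]]) blast
  have supp: "supporting_hyperplane G (chain_hyperplane C)" if C: "C \<in> ?M" for C
  proof -
    have "G \<inter> chain_hyperplane C \<noteq> {}" using facet[OF C] by (simp add: facet_of_def)
    moreover from this have "chain_normal C \<noteq> 0" by (auto simp: chain_hyperplane_eq)
    moreover have "G \<subseteq> {x. chain_normal C \<bullet> x \<le> 1}"
      unfolding G_def
    proof (intro convex_hull_subset_halfspace chain_normal_le_1)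
      show "Inl -` C \<in> Chains P" "Inr -` C \<in> Chains Q"
        using C by (auto simp only: UN_iff max_chains_Delta_iff[OF assms])
    qed
    ultimately show ?thesis
      unfolding supporting_hyperplane_def chain_hyperplane_eq
      by (intro exI[of _ "chain_normal C"] exI[of _ 1] conjI) simp_all
  qed
  \<comment> \<open>Faces of polyhedra are exposed, so every facet is cut out by a supporting
    hyperplane, to which \<open>chain\<close> applies.\<close>
  have facet_eq: "\<exists>C\<in>?M. F = G \<inter> chain_hyperplane C" if F: "F facet_of G" for F
  proof -
    have "polyhedron G"
      unfolding G_def by (simp add: finite_Gamma_vertices polyhedron_convex_hull)
    then have "F exposed_face_of G"
      using F by (simp add: exposed_face_of_polyhedron facet_of_imp_face_of)
    moreover have "F \<noteq> {}" "F \<noteq> G" using F by (auto simp: facet_of_def)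
    ultimately obtain a b where ab: "a \<noteq> 0" "G \<subseteq> {x. a \<bullet> x \<le> b}" "F = G \<inter> {x. a \<bullet> x = b}"
      unfolding exposed_face_of by blast
    obtain C where "C \<in> ?M" "{x. a \<bullet> x = b} = chain_hyperplane C"
      using chain[OF ab(1,2) F[unfolded ab(3)]] by (elim bexE)
    then show ?thesis unfolding ab(3) by (intro bexI[of _ C]) simp
  qed
  have "{H. \<exists>F. F facet_of G \<and> supporting_hyperplane G H \<and> G \<inter> H = F} = chain_hyperplane ` ?M"
    (is "?L = ?R")
  proof
    show "?L \<subseteq> ?R"
    proof
      fix H assume "H \<in> ?L"
      then obtain a b where ab: "a \<noteq> 0" "H = {x. a \<bullet> x = b}" "G \<subseteq> {x. a \<bullet> x \<le> b}"
        and F: "(G \<inter> H) facet_of G"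
        unfolding supporting_hyperplane_def by blast
      from chain[OF ab(1,3) F[unfolded ab(2)]] show "H \<in> ?R"
        by (simp only: ab(2) image_iff)
    qed
    show "?R \<subseteq> ?L"
    proof (rule image_subsetI, rule CollectI)
      fix C assume "C \<in> ?M"
      from facet[OF this] supp[OF this]
      show "\<exists>F. F facet_of G \<and> supporting_hyperplane G (chain_hyperplane C) \<and> G \<inter> chain_hyperplane C = F"
        by (intro exI[of _ "G \<inter> chain_hyperplane C"] conjI) simp_all
    qed
  qed
  moreover have "chain_hyperplane ` ?M =
      {chain_hyperplane C | W C. C \<in> max_chains (Delta_carrier W) (Delta W P Q)}"
    (is "_ = ?S")
  proof (intro equalityI subsetI)
    show "H \<in> ?S" if "H \<in> chain_hyperplane ` ?M" for H
      using that by (elim imageE UN_E) (intro CollectI exI conjI)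
    show "H \<in> chain_hyperplane ` ?M" if "H \<in> ?S" for H
      using that by (elim CollectE exE conjE) (simp only: imageI UN_I[OF UNIV_I])
  qed
  \<comment> \<open>Indexing by the union over \<open>W\<close> counts a chain arising for several
    \<open>W\<close> once, in agreement with its single facet.\<close>
  moreover have "bij_betw (\<lambda>C. G \<inter> chain_hyperplane C) ?M {F. F facet_of G}"
  proof (rule bij_betw_imageI)
    show "inj_on (\<lambda>C. G \<inter> chain_hyperplane C) ?M"
    proof (rule inj_onI)
      fix C C' assume "C \<in> ?M" "C' \<in> ?M" and eq: "G \<inter> chain_hyperplane C = G \<inter> chain_hyperplane C'"
      then obtain W W' where "C \<in> max_chains (Delta_carrier W) (Delta W P Q)"
        "C' \<in> max_chains (Delta_carrier W') (Delta W' P Q)"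
        by (elim UN_E)
      then have "C \<subseteq> Delta_carrier W" "C' \<subseteq> Delta_carrier W'"
        by (simp_all only: max_chains_Delta_iff[OF assms])
      then show "C = C'" using eq unfolding G_def by (rule chain_hyperplane_Gamma_inj)
    qed
    show "(\<lambda>C. G \<inter> chain_hyperplane C) ` ?M = {F. F facet_of G}"
    proof (intro equalityI subsetI)
      show "F \<in> {F. F facet_of G}" if "F \<in> (\<lambda>C. G \<inter> chain_hyperplane C) ` ?M" for F
        using that by (elim imageE) (simp only: mem_Collect_eq facet)
      show "F \<in> (\<lambda>C. G \<inter> chain_hyperplane C) ` ?M" if "F \<in> {F. F facet_of G}" for F
        using that facet_eq[of F] by (simp only: mem_Collect_eq image_iff)
    qed
  qed
  ultimately show ?thesis
    unfolding Gamma_polytope_eq G_def[symmetric]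
    by (simp only: bij_betw_same_card[symmetric] simp_thms)
qed

end
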